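(* Let $G$ be a nonabelian finite group and let $S\subseteq G$ be inverse-closed ($S=S^{-1}$) and not contain the identity. Then the Cayley graph $X=\Gamma(G,S)$ does not have average uniform mixing; that is, $\widehat{M}_X\ne\frac1{|G|}J_{|G|}$.
   Context: The Cayley graph $\Gamma(G,S)$ has vertex set $G$, with $g$ adjacent to $sg$ for each $g\in G$ and $s\in S$; its adjacency matrix is $A=\sum_{s\in S}R(s)$, where $R$ is the left-regular representation of $G$. For a graph $X$ of order $n$ with Hermitian adjacency matrix $A$, let $U_X(t)=e^{-itA}$ and $M_X(t)=U_X(t)\circ\overline{U_X(t)}$ (entrywise product). The average mixing matrix is $\widehat{M}_X=\lim_{T\to\infty}\frac1T\int_0^TM_X(t)\,dt$. $X$ has average uniform mixing if $\widehat{M}_X=\frac1nJ_n$, where $J_n$ is the $n\times n$ all-one matrix. *)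

theory Defs
  imports
    "HOL-Analysis.Analysis"
    "HOL-Algebra.Group"
    "Graph_Theory.Pair_Digraph"
begin

text \<open>
  Square matrices are indexed by the vertex set \<open>V\<close> itself: a matrix is a function
  \<open>'v \<Rightarrow> 'v \<Rightarrow> complex\<close> of which only the entries with both indices in \<open>V\<close> matter.
\<close>

type_synonym 'v cmatrix = "'v \<Rightarrow> 'v \<Rightarrow> complex"

definition cmatrix_mult :: "'v set \<Rightarrow> 'v cmatrix \<Rightarrow> 'v cmatrix \<Rightarrow> 'v cmatrix" where
  "cmatrix_mult V A B = (\<lambda>x y. \<Sum>z\<in>V. A x z * B z y)"

primrec cmatrix_power :: "'v set \<Rightarrow> 'v cmatrix \<Rightarrow> nat \<Rightarrow> 'v cmatrix" where
  "cmatrix_power V A 0 = (\<lambda>x y. if x = y then 1 else 0)"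
| "cmatrix_power V A (Suc k) = cmatrix_mult V A (cmatrix_power V A k)"

definition cmatrix_exp :: "'v set \<Rightarrow> 'v cmatrix \<Rightarrow> 'v cmatrix" where
  "cmatrix_exp V A = (\<lambda>x y. \<Sum>k. cmatrix_power V A k x y / fact k)"

text \<open>
  The entry at \<open>(x, y)\<close> records the arc from \<open>y\<close> to \<open>x\<close>, so that the matrix maps the indicator
  of a vertex to the sum of the indicators of its out-neighbours. For graphs with a symmetric
  arc set, the orientation is immaterial.
\<close>

definition adjacency_matrix :: "'v pair_pre_digraph \<Rightarrow> 'v cmatrix" where
  "adjacency_matrix X = (\<lambda>x y. if (y, x) \<in> parcs X then 1 else 0)"

definition transition_matrix :: "'v pair_pre_digraph \<Rightarrow> real \<Rightarrow> 'v cmatrix" where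
  "transition_matrix X t =
     cmatrix_exp (pverts X) (\<lambda>x y. - (\<i> * complex_of_real t) * adjacency_matrix X x y)"

definition mixing_matrix :: "'v pair_pre_digraph \<Rightarrow> real \<Rightarrow> 'v cmatrix" where
  "mixing_matrix X t = (\<lambda>x y. transition_matrix X t x y * cnj (transition_matrix X t x y))"

text \<open>
  The limit exists whenever the vertex set is finite and the adjacency matrix is Hermitian;
  otherwise the value of \<^const>\<open>Lim\<close> may be unspecified.
\<close>

definition average_mixing_matrix :: "'v pair_pre_digraph \<Rightarrow> 'v cmatrix" where
  "average_mixing_matrix X =
     (\<lambda>x y. Lim at_top
        (\<lambda>T::real. complex_of_real (1 / T) * integral {0..T} (\<lambda>t. mixing_matrix X t x y)))"

definition average_uniform_mixing :: "'v pair_pre_digraph \<Rightarrow> bool" where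
  "average_uniform_mixing X \<longleftrightarrow>
     (\<forall>x\<in>pverts X. \<forall>y\<in>pverts X. average_mixing_matrix X x y = 1 / of_nat (card (pverts X)))"

definition cayley_graph :: "('a, 'b) monoid_scheme \<Rightarrow> 'a set \<Rightarrow> 'a pair_pre_digraph" where
  "cayley_graph G S =
     \<lparr>pverts = carrier G, parcs = {(g, s \<otimes>\<^bsub>G\<^esub> g) | g s. g \<in> carrier G \<and> s \<in> S}\<rparr>"

definition left_regular_rep :: "('a, 'b) monoid_scheme \<Rightarrow> 'a \<Rightarrow> 'a cmatrix" where
  "left_regular_rep G s = (\<lambda>x y. if x = s \<otimes>\<^bsub>G\<^esub> y then 1 else 0)"

lemma parcs_cayley_graph_iff:
  assumes "y \<in> carrier G"
  shows "(y, x) \<in> parcs (cayley_graph G S) \<longleftrightarrow> (\<exists>s\<in>S. x = s \<otimes>\<^bsub>G\<^esub> y)"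
  unfolding cayley_graph_def using assms by auto

lemma adjacency_matrix_cayley_graph:
  assumes "group G" "finite S" "S \<subseteq> carrier G" "x \<in> carrier G" "y \<in> carrier G"
  shows "adjacency_matrix (cayley_graph G S) x y = (\<Sum>s\<in>S. left_regular_rep G s x y)"
proof -
  interpret group G by fact
  define c where "c = x \<otimes>\<^bsub>G\<^esub> inv\<^bsub>G\<^esub> y"
  have eq: "x = s \<otimes>\<^bsub>G\<^esub> y \<longleftrightarrow> s = c" if "s \<in> S" for s
    unfolding c_def using inv_solve_right[of s x y] subsetD[OF assms(3) that] assms(4,5) by simp
  have "(\<exists>s\<in>S. x = s \<otimes>\<^bsub>G\<^esub> y) \<longleftrightarrow> (\<exists>s\<in>S. s = c)"
    by (rule bex_cong[OF refl eq])
  then have "adjacency_matrix (cayley_graph G S) x y = (if c \<in> S then 1 else 0)"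
    by (simp add: adjacency_matrix_def parcs_cayley_graph_iff[OF assms(5)])
  also have "\<dots> = (\<Sum>s\<in>S. if s = c then 1 else 0)"
    using assms(2) by simp
  also have "\<dots> = (\<Sum>s\<in>S. left_regular_rep G s x y)"
    unfolding left_regular_rep_def by (rule sum.cong[OF refl]) (simp only: eq)
  finally show ?thesis .
qed

lemma hermitian_adjacency_matrix_cayley_graph:
  assumes "group G" "S \<subseteq> carrier G" "m_inv G ` S = S" "x \<in> carrier G" "y \<in> carrier G"
  shows "adjacency_matrix (cayley_graph G S) y x = cnj (adjacency_matrix (cayley_graph G S) x y)"
proof -
  interpret group G by fact
  have flip: "\<exists>s\<in>S. v = s \<otimes>\<^bsub>G\<^esub> u"
    if ex: "\<exists>s\<in>S. u = s \<otimes>\<^bsub>G\<^esub> v" and v: "v \<in> carrier G" for u v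
  proof -
    from ex obtain s where s: "s \<in> S" and u: "u = s \<otimes>\<^bsub>G\<^esub> v" by (rule bexE)
    have sc: "s \<in> carrier G" by (rule subsetD[OF assms(2) s])
    have "inv\<^bsub>G\<^esub> s \<otimes>\<^bsub>G\<^esub> u = (inv\<^bsub>G\<^esub> s \<otimes>\<^bsub>G\<^esub> s) \<otimes>\<^bsub>G\<^esub> v"
      unfolding u by (rule m_assoc[symmetric]) (use sc v in simp_all)
    also have "\<dots> = v" by (simp only: l_inv[OF sc] l_one[OF v])
    finally have "v = inv\<^bsub>G\<^esub> s \<otimes>\<^bsub>G\<^esub> u" by (rule sym)
    moreover have "inv\<^bsub>G\<^esub> s \<in> S"
      using imageI[OF s, of "m_inv G"] unfolding assms(3) .
    ultimately show ?thesis by (rule bexI)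
  qed
  have "(y, x) \<in> parcs (cayley_graph G S) \<longleftrightarrow> (x, y) \<in> parcs (cayley_graph G S)"
    unfolding parcs_cayley_graph_iff[OF assms(4)] parcs_cayley_graph_iff[OF assms(5)]
    by (rule iffI; erule flip) (rule assms(4,5))+
  then show ?thesis by (simp add: adjacency_matrix_def)
qed

end

(*
  The adjacency matrix acts on functions on G as convolution with a = 1_S, which is real and
  symmetric. As a is self-adjoint it has a spectral resolution a^k = sum theta^k f_theta into
  real symmetric idempotents f_theta of the group algebra that are polynomials in a. The diagonal
  entries of U(t) equal sum f_theta(1) exp(-i t theta), so those of the average mixing matrix are
  sum f_theta(1)^2.

  Idempotency gives |f_theta| <= f_theta(1) = sum_y f_theta(y)^2 <= n f_theta(1)^2. Since the
  f_theta sum to the unit of the group algebra, sum f_theta(1)^2 = 1/n forces equality throughout: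
  each nonzero f_theta has |f_theta| = 1/n and n f_theta is a character with values 1 and -1. Each
  f_theta thus takes the value f_theta(1) at every commutator, and so does their sum, the indicator
  of the identity: all commutators are trivial.
*)
theory Submission
  imports Defs "HOL-Computational_Algebra.Fundamental_Theorem_Algebra"
    "HOL-Real_Asymp.Real_Asymp"
begin

section \<open>Lagrange basis polynomials\<close>

definition lagrange_basis :: "'a :: field set \<Rightarrow> 'a \<Rightarrow> 'a poly" where
  "lagrange_basis A a = (\<Prod>b\<in>A - {a}. smult (1 / (a - b)) [:- b, 1:])"

lemma poly_lagrange_basis:
  assumes "finite A" "b \<in> A"
  shows "poly (lagrange_basis A a) b = (if b = a then 1 else 0)"
proof (cases "b = a")
  case True
  then show ?thesis
    by (auto simp: lagrange_basis_def poly_prod diff_divide_distrib[symmetric] intro!: prod.neutral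
        split: if_splits)
next
  case False
  then show ?thesis
    using assms by (auto simp: lagrange_basis_def poly_prod intro!: prod_zero bexI[of _ b])
qed

section \<open>The group algebra element of a symmetric subset\<close>

context group
begin

lemma sum_carrier_mult_right:
  fixes h :: "'a \<Rightarrow> 'c :: comm_monoid_add"
  assumes "y \<in> carrier G"
  shows "(\<Sum>z\<in>carrier G. h (z \<otimes> y)) = (\<Sum>z\<in>carrier G. h z)"
proof (rule sum.reindex_bij_witness[of _ "\<lambda>z. z \<otimes> inv y" "\<lambda>z. z \<otimes> y"])
qed (use assms in \<open>auto simp: m_assoc\<close>)

lemma sum_carrier_div:
  fixes h :: "'a \<Rightarrow> 'c :: comm_monoid_add"
  assumes "x \<in> carrier G"
  shows "(\<Sum>y\<in>carrier G. h (x \<otimes> inv y)) = (\<Sum>y\<in>carrier G. h y)"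
proof (rule sum.reindex_bij_witness[of _ "\<lambda>y. inv y \<otimes> x" "\<lambda>y. x \<otimes> inv y"])
  show "x \<otimes> inv (inv y \<otimes> x) = y" if "y \<in> carrier G" for y
    using assms that by (simp add: inv_mult_group m_assoc[symmetric])
qed (use assms in \<open>auto simp: m_assoc inv_mult_group\<close>)

end

section \<open>The complex group algebra with its convolution product\<close>

locale symmetric_subset = group G for G (structure) +
  fixes S :: "'a set"
  assumes finite_carrier: "finite (carrier G)"
    and subset: "S \<subseteq> carrier G"
    and image_inv: "m_inv G ` S = S"
begin

text \<open>The product of the group algebra. The value 0 outside the carrier lets associativity and
  \<open>ev p = (\<lambda>_. 0)\<close> be stated as equations between functions.\<close>

definition conv :: "('a \<Rightarrow> complex) \<Rightarrow> ('a \<Rightarrow> complex) \<Rightarrow> 'a \<Rightarrow> complex" where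
  "conv f g = (\<lambda>x. if x \<in> carrier G then \<Sum>y\<in>carrier G. f (x \<otimes> inv y) * g y else 0)"

definition unit :: "'a \<Rightarrow> complex" where
  "unit x = (if x = \<one> then 1 else 0)"

definition gen :: "'a \<Rightarrow> complex" where
  "gen x = (if x \<in> S then 1 else 0)"

text \<open>Horner's rule for the value of \<open>p\<close> at \<open>gen\<close> in the group
  algebra.\<close>

definition ev :: "complex poly \<Rightarrow> 'a \<Rightarrow> complex" where
  "ev p = fold_coeffs (\<lambda>c f x. c * unit x + conv gen f x) p (\<lambda>_. 0)"

lemma gen_inv: "x \<in> carrier G \<Longrightarrow> gen (inv x) = gen x"
  using image_inv subset unfolding gen_def by (metis image_eqI inv_inv)

lemma cnj_gen [simp]: "cnj (gen x) = gen x"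
  by (simp add: gen_def)

lemma cnj_unit [simp]: "cnj (unit x) = unit x"
  by (simp add: unit_def)

lemma conv_zero_right: "conv f (\<lambda>_. 0) = (\<lambda>_. 0)"
  by (simp add: conv_def fun_eq_iff)

lemma conv_zero_left: "conv (\<lambda>_. 0) f = (\<lambda>_. 0)"
  by (simp add: conv_def fun_eq_iff)

lemma conv_add_right: "conv f (\<lambda>x. g x + h x) x = conv f g x + conv f h x"
  by (simp add: conv_def sum.distrib distrib_left)

lemma conv_add_left: "conv (\<lambda>x. g x + h x) f x = conv g f x + conv h f x"
  by (simp add: conv_def sum.distrib distrib_right)

lemma conv_scale_right: "conv f (\<lambda>x. c * g x) x = c * conv f g x"
  by (simp add: conv_def sum_distrib_left mult_ac)

lemma conv_scale_left: "conv (\<lambda>x. c * g x) f x = c * conv g f x"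
  by (simp add: conv_def sum_distrib_left mult_ac)

lemma conv_unit_left:
  assumes "x \<in> carrier G"
  shows "conv unit f x = f x"
proof -
  have "x \<otimes> inv y = \<one> \<longleftrightarrow> y = x" if "y \<in> carrier G" for y
    using assms that by (metis inv_closed inv_equality inv_inv m_closed r_inv)
  then have "conv unit f x = (\<Sum>y\<in>carrier G. if y = x then f y else 0)"
    using assms by (auto simp: conv_def unit_def intro!: sum.cong)
  with assms finite_carrier show ?thesis by simp
qed

lemma conv_unit_right:
  assumes "x \<in> carrier G"
  shows "conv f unit x = f x"
proof -
  have "conv f unit x = (\<Sum>y\<in>carrier G. if y = \<one> then f (x \<otimes> inv y) else 0)"
    using assms by (auto simp: conv_def unit_def intro!: sum.cong)
  with assms finite_carrier show ?thesis by simp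
qed

lemma conv_assoc: "conv (conv f g) h = conv f (conv g h)"
proof
  fix x
  show "conv (conv f g) h x = conv f (conv g h) x"
  proof (cases "x \<in> carrier G")
    case x: True
    have "conv (conv f g) h x =
      (\<Sum>y\<in>carrier G. \<Sum>z\<in>carrier G. f (x \<otimes> inv y \<otimes> inv z) * g z * h y)"
      using x by (simp add: conv_def sum_distrib_right)
    also have "\<dots> = (\<Sum>y\<in>carrier G. \<Sum>z\<in>carrier G. f (x \<otimes> inv z) * g (z \<otimes> inv y) * h y)"
    proof (rule sum.cong[OF refl])
      fix y assume y: "y \<in> carrier G"
      have "(\<Sum>z\<in>carrier G. f (x \<otimes> inv z) * g (z \<otimes> inv y) * h y) =
        (\<Sum>z\<in>carrier G. f (x \<otimes> inv (z \<otimes> y)) * g (z \<otimes> y \<otimes> inv y) * h y)"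
        by (rule sum_carrier_mult_right[OF y, symmetric])
      also have "\<dots> = (\<Sum>z\<in>carrier G. f (x \<otimes> inv y \<otimes> inv z) * g z * h y)"
        using x y by (intro sum.cong refl) (simp add: inv_mult_group m_assoc)
      finally show "(\<Sum>z\<in>carrier G. f (x \<otimes> inv y \<otimes> inv z) * g z * h y) =
        (\<Sum>z\<in>carrier G. f (x \<otimes> inv z) * g (z \<otimes> inv y) * h y)" by simp
    qed
    also have "\<dots> = conv f (conv g h) x"
      using x by (subst sum.swap) (simp add: conv_def sum_distrib_left mult.assoc)
    finally show ?thesis .
  qed (simp add: conv_def)
qed

section \<open>Polynomials in \<open>gen\<close>\<close>

lemma ev_0 [simp]: "ev 0 = (\<lambda>_. 0)"
  by (simp add: ev_def)

lemma ev_pCons: "ev (pCons c p) x = c * unit x + conv gen (ev p) x"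
\<comment> \<open>\<open>pCons 0 0\<close> is the zero polynomial, on which
  \<open>fold_coeffs\<close> makes no step; there both sides are 0.\<close>
proof (cases "c = 0 \<and> p = 0")
  case True
  then show ?thesis by (simp add: conv_def)
next
  case False
  then show ?thesis by (cases "c = 0") (simp_all add: ev_def)
qed

lemma ev_pCons_fun: "ev (pCons c p) = (\<lambda>x. c * unit x + conv gen (ev p) x)"
  by (rule ext) (rule ev_pCons)

lemma ev_outside: "x \<notin> carrier G \<Longrightarrow> ev p x = 0"
  by (cases p) (auto simp: ev_pCons conv_def unit_def)

lemma ev_add: "ev (p + q) x = ev p x + ev q x"
proof (induction p q arbitrary: x rule: poly_induct2)
  case (pCons a p b q)
  then have "ev (p + q) = (\<lambda>x. ev p x + ev q x)" by auto
  then show ?case by (simp add: ev_pCons conv_add_right algebra_simps)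
qed simp

lemma ev_smult: "ev (smult c p) x = c * ev p x"
proof (induction p arbitrary: x)
  case (pCons a p)
  then have "ev (smult c p) = (\<lambda>x. c * ev p x)" by auto
  then show ?case by (simp add: ev_pCons conv_scale_right algebra_simps)
qed simp

lemma ev_diff: "ev (p - q) x = ev p x - ev q x"
  using ev_add[of p "smult (-1) q" x] unfolding ev_smult by simp

lemma ev_sum: "ev (\<Sum>i\<in>I. p i) x = (\<Sum>i\<in>I. ev (p i) x)"
  by (induction I rule: infinite_finite_induct) (simp_all add: ev_add)

lemma ev_1: "ev 1 x = unit x"
  by (simp add: one_pCons ev_pCons conv_zero_right)

text \<open>Makes evaluation a ring homomorphism; in particular all \<open>ev p\<close> commute with
  each other, whether or not \<open>G\<close> is abelian.\<close>

lemma ev_mult: "ev (p * q) = conv (ev p) (ev q)"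
proof (induction p)
  case 0
  then show ?case by (simp add: conv_zero_left)
next
  case (pCons c p)
  show ?case
  proof
    fix x
    have "ev (pCons c p * q) x = c * ev q x + conv gen (conv (ev p) (ev q)) x"
      using pCons.IH by (simp add: ev_add ev_smult ev_pCons)
    \<comment> \<open>\<open>unit\<close> is a left identity only on the carrier; outside it
      everything vanishes.\<close>
    also have "\<dots> = conv (\<lambda>x. c * unit x + conv gen (ev p) x) (ev q) x"
      by (cases "x \<in> carrier G")
        (simp_all add: conv_add_left conv_scale_left conv_unit_left conv_assoc ev_outside,
         simp add: conv_def)
    finally show "ev (pCons c p * q) x = conv (ev (pCons c p)) (ev q) x"
      by (simp add: ev_pCons_fun)
  qed
qed

lemma ev_linear_factor: "ev ([:- z, 1:] * p) x = conv gen (ev p) x - z * ev p x"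
  using ev_diff[of "pCons 0 p" "smult z p" x] by (simp add: ev_smult ev_pCons)

text \<open>Holds because \<open>gen\<close> and \<open>unit\<close> are real-valued.\<close>

lemma ev_cnj: "ev (map_poly cnj p) x = cnj (ev p x)"
proof (induction p arbitrary: x)
  case (pCons c p)
  then have "ev (map_poly cnj p) = (\<lambda>x. cnj (ev p x))" by auto
  then show ?case by (simp add: map_poly_pCons ev_pCons conv_def)
qed simp

lemma ev_X: "x \<in> carrier G \<Longrightarrow> ev [:0, 1:] x = gen x"
  using conv_unit_right[of x gen] ev_1
  by (simp add: ev_pCons_fun conv_zero_right)

lemma gen_outside: "x \<notin> carrier G \<Longrightarrow> gen x = 0"
  using subset by (auto simp: gen_def)

lemma ev_X_fun: "ev [:0, 1:] = gen"
  by (rule ext) (metis ev_X ev_outside gen_outside)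

text \<open>Inversion reverses convolution products and fixes \<open>gen\<close>. The reversal does
  no harm, as \<open>ev p\<close> commutes with \<open>gen\<close>.\<close>

lemma ev_inv: "x \<in> carrier G \<Longrightarrow> ev p (inv x) = ev p x"
proof (induction p arbitrary: x)
  case (pCons c p)
  have "conv gen (ev p) (inv x) = (\<Sum>y\<in>carrier G. gen (inv x \<otimes> inv y) * ev p y)"
    using pCons.prems by (simp add: conv_def)
  also have "\<dots> = (\<Sum>y\<in>carrier G. gen (inv (y \<otimes> x)) * ev p (inv y))"
    using pCons by (intro sum.cong refl) (simp add: inv_mult_group)
  also have "\<dots> = (\<Sum>y\<in>carrier G. ev p (x \<otimes> inv (y \<otimes> x)) * gen (y \<otimes> x))"
  proof (rule sum.cong[OF refl])
    fix y assume y: "y \<in> carrier G"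
    have "x \<otimes> inv (y \<otimes> x) = inv y"
      using pCons.prems y by (simp add: inv_mult_group m_assoc[symmetric])
    then show "gen (inv (y \<otimes> x)) * ev p (inv y) = ev p (x \<otimes> inv (y \<otimes> x)) * gen (y \<otimes> x)"
      using pCons.prems y gen_inv[of "y \<otimes> x"] by (simp only: m_closed mult.commute)
  qed
  also have "\<dots> = conv (ev p) gen x"
    using pCons.prems sum_carrier_mult_right[of x "\<lambda>y. ev p (x \<otimes> inv y) * gen y"]
    by (simp add: conv_def)
  also have "\<dots> = conv gen (ev p) x"
    by (metis ev_X_fun ev_mult mult.commute)
  finally show ?case using pCons.prems by (simp add: ev_pCons unit_def inv_eq_1_iff)
qed simp

section \<open>Self-adjointness of convolution by \<open>gen\<close>, and annihilating
  polynomials\<close>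

lemma gen_selfadjoint:
  "(\<Sum>x\<in>carrier G. cnj (u x) * conv gen v x) = (\<Sum>x\<in>carrier G. cnj (conv gen u x) * v x)"
proof -
  have "(\<Sum>x\<in>carrier G. cnj (u x) * conv gen v x) =
      (\<Sum>x\<in>carrier G. \<Sum>y\<in>carrier G. cnj (u x) * gen (x \<otimes> inv y) * v y)"
    by (simp add: conv_def sum_distrib_left mult_ac)
  also have "\<dots> = (\<Sum>y\<in>carrier G. \<Sum>x\<in>carrier G. cnj (u x) * gen (x \<otimes> inv y) * v y)"
    by (rule sum.swap)
  \<comment> \<open>The kernel \<open>gen (x \<otimes> inv y)\<close> is symmetric in
    \<open>x\<close> and \<open>y\<close> since \<open>S\<close> is inverse-closed; being real, it
    is Hermitian.\<close>
  also have "\<dots> = (\<Sum>y\<in>carrier G. \<Sum>x\<in>carrier G. cnj (u x) * gen (y \<otimes> inv x) * v y)"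
  proof (intro sum.cong refl)
    fix x y assume xy: "x \<in> carrier G" "y \<in> carrier G"
    then have "gen (y \<otimes> inv x) = gen (x \<otimes> inv y)"
      using gen_inv[of "x \<otimes> inv y"] by (simp add: inv_mult_group)
    then show "cnj (u x) * gen (x \<otimes> inv y) * v y = cnj (u x) * gen (y \<otimes> inv x) * v y" by simp
  qed
  also have "\<dots> = (\<Sum>x\<in>carrier G. cnj (conv gen u x) * v x)"
    by (simp add: conv_def sum_distrib_left sum_distrib_right mult_ac)
  finally show ?thesis .
qed

lemma sum_cnj_self_eq_0:
  assumes "(\<Sum>x\<in>carrier G. cnj (ev p x) * ev p x) = 0"
  shows "ev p = (\<lambda>_. 0)"
proof -
  have "complex_of_real (\<Sum>x\<in>carrier G. (cmod (ev p x))\<^sup>2) = 0"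
    using assms by (simp add: complex_norm_square mult.commute del: of_real_power)
  then have "(\<Sum>x\<in>carrier G. (cmod (ev p x))\<^sup>2) = 0"
    by (simp only: of_real_eq_0_iff)
  then have "\<forall>x\<in>carrier G. ev p x = 0"
    using finite_carrier by (subst (asm) sum_nonneg_eq_0_iff) auto
  then show ?thesis using ev_outside by blast
qed

text \<open>
  Asking for arbitrarily large degree provides two independent solutions at the induction step.
\<close>

lemma exists_high_degree_annihilator:
  assumes "finite V"
  shows "\<exists>p. degree p > N \<and> (\<forall>x\<in>V. ev p x = 0)"
  using assms
proof (induction V arbitrary: N rule: finite_induct)
  case empty
  have "degree (monom (1::complex) (Suc N)) > N" by (simp add: degree_monom_eq)
  then show ?case by blast
next
  case (insert v V)
  obtain p where p: "degree p > N" "\<forall>x\<in>V. ev p x = 0" using insert.IH by blast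
  obtain q where q: "degree q > degree p" "\<forall>x\<in>V. ev q x = 0" using insert.IH by blast
  show ?case
  proof (cases "ev p v = 0")
    case True
    with p show ?thesis by auto
  next
    case False
    \<comment> \<open>This combination cancels the value at \<open>v\<close>, and \<open>q\<close>
      dominates its degree.\<close>
    define r where "r = q - smult (ev q v / ev p v) p"
    have "degree (smult (ev q v / ev p v) p) < degree q"
      using q(1) degree_smult_le[of "ev q v / ev p v" p] by simp
    then have "degree r = degree q"
      using degree_add_eq_left[of "- smult (ev q v / ev p v) p" q] by (simp add: r_def)
    moreover have "\<forall>x\<in>insert v V. ev r x = 0"
      using p(2) q(2) False by (auto simp: r_def ev_diff ev_smult)
    ultimately show ?thesis using p(1) q(1) by (intro exI[of _ r]) auto
  qed
qed

lemma exists_annihilator: "\<exists>p. p \<noteq> 0 \<and> ev p = (\<lambda>_. 0)"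
proof -
  obtain p where "degree p > 0" "\<forall>x\<in>carrier G. ev p x = 0"
    using exists_high_degree_annihilator[OF finite_carrier] by blast
  then have "p \<noteq> 0 \<and> ev p = (\<lambda>_. 0)" using ev_outside by (metis degree_0 less_irrefl)
  then show ?thesis ..
qed

text \<open>Otherwise \<open>ev h\<close> would be an eigenvector of a self-adjoint operator with
  nonreal eigenvalue \<open>z\<close>.\<close>

lemma ev_eq_0_if_nonreal_factor:
  assumes "z \<notin> \<real>" "ev ([:- z, 1:] * h) = (\<lambda>_. 0)"
  shows "ev h = (\<lambda>_. 0)"
proof (rule sum_cnj_self_eq_0)
  let ?s = "\<Sum>x\<in>carrier G. cnj (ev h x) * ev h x"
  have eigen: "conv gen (ev h) x = z * ev h x" for x
    using fun_cong[OF assms(2), of x] by (simp add: ev_linear_factor del: mult_pCons_left)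
  have "z * ?s = cnj z * ?s"
    using gen_selfadjoint[of "ev h" "ev h"] by (simp add: eigen sum_distrib_left mult_ac)
  then show "?s = 0" using assms(1) by (auto simp: Reals_cnj_iff)
qed

text \<open>A self-adjoint operator has no nilpotent part: with b = \<open>gen\<close> - z for real
  z, the squared norm of b h is the inner product of b b h with h, which is 0.\<close>

lemma ev_eq_0_if_square_factor:
  assumes "z \<in> \<real>" "ev ([:- z, 1:] * ([:- z, 1:] * h)) = (\<lambda>_. 0)"
  shows "ev ([:- z, 1:] * h) = (\<lambda>_. 0)"
proof (rule sum_cnj_self_eq_0)
  define w where "w = ev ([:- z, 1:] * h)"
  have w: "w x = conv gen (ev h) x - z * ev h x" for x
    unfolding w_def by (rule ev_linear_factor)
  have eigen: "conv gen w x = z * w x" for x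
    using fun_cong[OF assms(2), of x] ev_linear_factor[of z "[:- z, 1:] * h" x]
    by (simp add: w_def del: mult_pCons_left)
  have "(\<Sum>x\<in>carrier G. cnj (w x) * w x) =
    (\<Sum>x\<in>carrier G. cnj (w x) * conv gen (ev h) x) - (\<Sum>x\<in>carrier G. cnj (w x) * (z * ev h x))"
    by (subst (2) w) (simp add: right_diff_distrib sum_subtractf)
  also have "\<dots> = 0"
    using assms(1) by (simp add: gen_selfadjoint eigen Reals_cnj_iff mult_ac)
  finally show "(\<Sum>x\<in>carrier G. cnj (ev ([:- z, 1:] * h) x) * ev ([:- z, 1:] * h) x) = 0"
    by (simp only: w_def)
qed

text \<open>
  Stripping the linear factors off \<open>p\<close> one at a time replaces the use of a minimal polynomial:
  a nonreal factor is injective, and a real one is already present in \<open>q\<close>.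
\<close>

lemma ev_eq_0_if_vanishing_on_real_roots:
  assumes "p \<noteq> 0" "ev (p * q) = (\<lambda>_. 0)" "\<And>z. z \<in> \<real> \<Longrightarrow> poly p z = 0 \<Longrightarrow> poly q z = 0"
  shows "ev q = (\<lambda>_. 0)"
  using assms
proof (induction "degree p" arbitrary: p)
  case 0
  then obtain c where "p = [:c:]" "c \<noteq> 0" by (metis degree_eq_zeroE pCons_0_0)
  then have "c * ev q x = 0" for x
    using fun_cong[OF "0.prems"(2), of x] by (simp add: ev_smult)
  with \<open>c \<noteq> 0\<close> show ?case by auto
next
  case (Suc n)
  then have "\<not> constant (poly p)" by (simp add: constant_degree)
  then obtain z where z: "poly p z = 0" using fundamental_theorem_of_algebra by blast
  then obtain p' where p: "p = [:- z, 1:] * p'" unfolding poly_eq_0_iff_dvd by (rule dvdE)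
  with Suc.prems(1) have p': "p' \<noteq> 0" by auto
  have deg: "n = degree p'"
    using Suc.hyps(2) p' degree_mult_eq[of "[:- z, 1:]" p'] unfolding p by simp
  have eq: "p * q = [:- z, 1:] * (p' * q)" by (simp only: p mult.assoc)
  have "ev (p' * q) = (\<lambda>_. 0)"
  proof (cases "z \<in> \<real>")
    case False
    then show ?thesis using Suc.prems(2) unfolding eq by (rule ev_eq_0_if_nonreal_factor)
  next
    case True
    then have "poly q z = 0" using z by (rule Suc.prems(3))
    then obtain q' where "q = [:- z, 1:] * q'" unfolding poly_eq_0_iff_dvd by (rule dvdE)
    then have "p' * q = [:- z, 1:] * (p' * q')" by (simp only: mult.left_commute)
    with True Suc.prems(2) show ?thesis unfolding eq by (simp only: ev_eq_0_if_square_factor)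
  qed
  moreover have "poly q y = 0" if "y \<in> \<real>" "poly p' y = 0" for y
    using Suc.prems(3)[OF that(1)] that(2) by (simp add: p)
  ultimately show ?case using Suc.hyps(1)[OF deg p'] by blast
qed

section \<open>Spectral resolution of \<open>gen\<close>\<close>

lemma exists_spectrum:
  obtains Z where "finite Z" "Z \<subseteq> \<real>"
    "\<And>q. (\<And>z. z \<in> Z \<Longrightarrow> poly q z = 0) \<Longrightarrow> ev q = (\<lambda>_. 0)"
proof -
  obtain p where p: "p \<noteq> 0" "ev p = (\<lambda>_. 0)" using exists_annihilator by blast
  \<comment> \<open>The real roots of an annihilator may include more than the eigenvalues; the
    extra ones only lead to zero idempotents.\<close>
  have "ev q = (\<lambda>_. 0)" if "\<And>z. z \<in> {z \<in> \<real>. poly p z = 0} \<Longrightarrow> poly q z = 0" for q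
  proof (rule ev_eq_0_if_vanishing_on_real_roots[OF p(1)])
    show "ev (p * q) = (\<lambda>_. 0)" by (simp add: ev_mult p(2) conv_zero_left)
  qed (use that in auto)
  moreover have "finite {z \<in> \<real>. poly p z = 0}"
    using poly_roots_finite[OF p(1)] by (rule rev_finite_subset) auto
  ultimately show thesis by (intro that[of "{z \<in> \<real>. poly p z = 0}"]) auto
qed

text \<open>The spectral idempotents are the Lagrange basis polynomials of the spectrum evaluated at
  \<open>gen\<close>. Every identity between polynomials in \<open>gen\<close> then reduces to
  comparing values on \<open>Z\<close>.\<close>

lemma exists_spectral_decomposition:
  obtains \<Theta> :: "real set" and f where "finite \<Theta>"
    "\<And>k x. x \<in> carrier G \<Longrightarrow> ev (monom 1 k) x = (\<Sum>\<theta>\<in>\<Theta>. of_real (\<theta> ^ k * f \<theta> x))"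
    "\<And>\<theta> x. \<theta> \<in> \<Theta> \<Longrightarrow> x \<in> carrier G \<Longrightarrow>
      (\<Sum>y\<in>carrier G. f \<theta> (x \<otimes> inv y) * f \<theta> y) = f \<theta> x"
    "\<And>\<theta> x. \<theta> \<in> \<Theta> \<Longrightarrow> x \<in> carrier G \<Longrightarrow> f \<theta> (inv x) = f \<theta> x"
proof -
  obtain Z where Z: "finite Z" "Z \<subseteq> \<real>"
    and vanish: "\<And>q. (\<And>z. z \<in> Z \<Longrightarrow> poly q z = 0) \<Longrightarrow> ev q = (\<lambda>_. 0)"
    by (rule exists_spectrum) (rule that; blast)
  have ev_cong: "ev p = ev q" if "\<And>z. z \<in> Z \<Longrightarrow> poly p z = poly q z" for p q
    using vanish[of "p - q"] that by (auto simp: fun_eq_iff ev_diff)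
  define \<Theta> where "\<Theta> = Re ` Z"
  have "of_real (Re z) = z" if "z \<in> Z" for z
    using Z(2) that by (auto intro: of_real_Re)
  then have ZT: "Z = of_real ` \<Theta>"
    by (simp add: \<Theta>_def image_image)
  define l where "l \<theta> = lagrange_basis Z (complex_of_real \<theta>)" for \<theta>
  have poly_l: "poly (l \<theta>) z = (if z = of_real \<theta> then 1 else 0)" if "z \<in> Z" for \<theta> z
    using poly_lagrange_basis[OF Z(1) that] by (simp add: l_def)
  define f where "f \<theta> x = Re (ev (l \<theta>) x)" for \<theta> x
  \<comment> \<open>Conjugating the coefficients does not change the values 0 and 1 at real points,
    so the idempotents are real-valued.\<close>
  have "ev (map_poly cnj (l \<theta>)) = ev (l \<theta>)" for \<theta>
    using Z(2) by (intro ev_cong) (auto simp: poly_l ZT)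
  then have "cnj (ev (l \<theta>) x) = ev (l \<theta>) x" for \<theta> x
    by (metis ev_cnj)
  then have real: "ev (l \<theta>) x = of_real (f \<theta> x)" for \<theta> x
    by (metis f_def Reals_cnj_iff of_real_Re)
  have "finite \<Theta>" using Z(1) by (simp add: \<Theta>_def)
  moreover have "ev (monom 1 k) x = (\<Sum>\<theta>\<in>\<Theta>. of_real (\<theta> ^ k * f \<theta> x))" for k x
  proof -
    \<comment> \<open>Lagrange interpolation of X^k on \<open>Z\<close>.\<close>
    have "ev (monom 1 k) = ev (\<Sum>\<theta>\<in>\<Theta>. smult (of_real (\<theta> ^ k)) (l \<theta>))"
    proof (rule ev_cong)
      fix z assume "z \<in> Z"
      then obtain \<phi> where \<phi>: "z = of_real \<phi>" "\<phi> \<in> \<Theta>" by (auto simp: ZT)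
      have "poly (\<Sum>\<theta>\<in>\<Theta>. smult (of_real (\<theta> ^ k)) (l \<theta>)) z =
        (\<Sum>\<theta>\<in>\<Theta>. if \<theta> = \<phi> then of_real \<theta> ^ k else 0)"
        using poly_l[OF \<open>z \<in> Z\<close>] by (auto simp: poly_sum \<phi>(1) intro!: sum.cong)
      with \<phi> \<open>finite \<Theta>\<close> show "poly (monom 1 k) z = poly (\<Sum>\<theta>\<in>\<Theta>. smult (of_real (\<theta> ^ k)) (l \<theta>)) z"
        by (simp add: poly_monom)
    qed
    then show ?thesis by (simp add: ev_sum ev_smult real)
  qed
  moreover have "(\<Sum>y\<in>carrier G. f \<theta> (x \<otimes> inv y) * f \<theta> y) = f \<theta> x" if "x \<in> carrier G" for \<theta> x
  proof -
    \<comment> \<open>A polynomial with values 0 and 1 on \<open>Z\<close> agrees there with its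
      square.\<close>
    have "ev (l \<theta> * l \<theta>) = ev (l \<theta>)" by (rule ev_cong) (simp add: poly_l)
    then have "conv (ev (l \<theta>)) (ev (l \<theta>)) x = ev (l \<theta>) x" by (simp only: ev_mult)
    then have "complex_of_real (\<Sum>y\<in>carrier G. f \<theta> (x \<otimes> inv y) * f \<theta> y) = of_real (f \<theta> x)"
      using that by (simp add: conv_def real)
    then show ?thesis by (simp only: of_real_eq_iff)
  qed
  moreover have "f \<theta> (inv x) = f \<theta> x" if "x \<in> carrier G" for \<theta> x
    using ev_inv[OF that] by (simp add: f_def)
  ultimately show thesis by (intro that)
qed

section \<open>From adjacency matrix powers to powers of \<open>gen\<close>\<close>

lemma adjacency_matrix_eq_gen:
  assumes "x \<in> carrier G" "y \<in> carrier G"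
  shows "adjacency_matrix (cayley_graph G S) x y = gen (x \<otimes> inv y)"
proof -
  have "(\<exists>s\<in>S. x = s \<otimes> y) \<longleftrightarrow> x \<otimes> inv y \<in> S"
    using assms subset by (metis inv_solve_right' subsetD inv_closed m_closed)
  then show ?thesis
    by (simp add: adjacency_matrix_def parcs_cayley_graph_iff[OF assms(2)] gen_def)
qed

text \<open>The column at \<one> starts as \<open>unit\<close>, and each multiplication by the
  matrix convolves it with \<open>c\<close> times \<open>gen\<close>.\<close>

lemma cmatrix_power_adjacency:
  assumes "x \<in> carrier G"
  shows "cmatrix_power (carrier G) (\<lambda>x y. c * adjacency_matrix (cayley_graph G S) x y) k x \<one> =
    c ^ k * ev (monom 1 k) x"
  using assms
proof (induction k arbitrary: x)
  case 0
  then show ?case by (simp add: ev_1 unit_def)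
next
  case (Suc k)
  then show ?case
    by (simp add: cmatrix_mult_def adjacency_matrix_eq_gen monom_Suc ev_pCons conv_def
        sum_distrib_left mult_ac)
qed

end

section \<open>Time averages of trigonometric sums\<close>

text \<open>For nonzero \<open>a\<close> the integral is bounded by 2/|a| independently of
  \<open>T\<close>, so dividing by \<open>T\<close> sends it to 0.\<close>

lemma average_exp_tendsto:
  "((\<lambda>T::real. complex_of_real (1 / T) * integral {0..T} (\<lambda>t. exp (\<i> * of_real a * of_real t)))
    \<longlongrightarrow> (if a = 0 then 1 else 0)) at_top"
proof (cases "a = 0")
  case True
  have "\<forall>\<^sub>F T::real in at_top. complex_of_real (1 / T) *
      integral {0..T} (\<lambda>t. exp (\<i> * of_real a * of_real t)) = 1"
    using eventually_gt_at_top[of 0] by eventually_elim (simp add: True scaleR_conv_of_real)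
  then show ?thesis by (simp add: True tendsto_eventually)
next
  case False
  have "((\<lambda>T::real. 2 / \<bar>a\<bar> * (1 / T)) \<longlongrightarrow> 0) at_top"
    by real_asymp
  moreover have "\<forall>\<^sub>F T::real in at_top. norm (complex_of_real (1 / T) *
      integral {0..T} (\<lambda>t. exp (\<i> * of_real a * of_real t))) \<le> 2 / \<bar>a\<bar> * (1 / T)"
    using eventually_gt_at_top[of 0]
  proof eventually_elim
    case (elim T)
    have "norm (exp (\<i> * of_real a * of_real T) - 1) \<le> norm (exp (\<i> * of_real a * of_real T)) + 1"
      using norm_triangle_ineq4[of "exp (\<i> * of_real a * of_real T)" 1] by simp
    also have "\<dots> = 2" by (simp add: norm_exp_eq_Re)
    finally have "norm (exp (\<i> * of_real a * of_real T) - 1) / \<bar>a\<bar> / T \<le> 2 / \<bar>a\<bar> / T"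
      using elim by (intro divide_right_mono) auto
    then show ?case
      using elim False
        Kronecker_Approximation_Theorem.integral_exp[of T "\<i> * of_real a"]
      by (simp add: norm_mult norm_divide mult_ac)
  qed
  ultimately show ?thesis using False by (simp add: Lim_null_comparison)
qed

text \<open>The expanded product has frequencies \<phi> - \<theta>. Averaging kills all nonzero
  ones, which leaves the diagonal because the elements of \<Theta> are distinct.\<close>

lemma average_norm_square_tendsto:
  fixes c :: "real \<Rightarrow> real"
  assumes "finite \<Theta>"
  defines "u \<equiv> \<lambda>t::real. \<Sum>\<theta>\<in>\<Theta>. of_real (c \<theta>) * exp (- (\<i> * of_real t) * of_real \<theta>)"
  shows "((\<lambda>T::real. complex_of_real (1 / T) * integral {0..T} (\<lambda>t. u t * cnj (u t)))
    \<longlongrightarrow> of_real (\<Sum>\<theta>\<in>\<Theta>. (c \<theta>)\<^sup>2)) at_top"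
proof -
  define e where "e a t = exp (\<i> * of_real a * of_real t)" for a t :: real
  have e_int: "e a integrable_on {0..T}" for a T
    unfolding e_def by (intro integrable_continuous_interval continuous_intros)
  have u: "u t * cnj (u t) = (\<Sum>\<theta>\<in>\<Theta>. \<Sum>\<phi>\<in>\<Theta>. of_real (c \<theta> * c \<phi>) * e (\<phi> - \<theta>) t)" for t
    unfolding u_def e_def cnj_sum sum_product
    by (intro sum.cong refl) (simp add: exp_cnj exp_add[symmetric] algebra_simps)
  have int: "integral {0..T} (\<lambda>t. u t * cnj (u t)) =
      (\<Sum>\<theta>\<in>\<Theta>. \<Sum>\<phi>\<in>\<Theta>. of_real (c \<theta> * c \<phi>) * integral {0..T} (e (\<phi> - \<theta>)))" for T
    unfolding u
    by (intro integral_unique has_integral_sum has_integral_mult_right assms(1)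
        integrable_integral e_int)
  have "((\<lambda>T::real. \<Sum>\<theta>\<in>\<Theta>. \<Sum>\<phi>\<in>\<Theta>.
      of_real (c \<theta> * c \<phi>) * (complex_of_real (1 / T) * integral {0..T} (e (\<phi> - \<theta>))))
    \<longlongrightarrow> (\<Sum>\<theta>\<in>\<Theta>. \<Sum>\<phi>\<in>\<Theta>. of_real (c \<theta> * c \<phi>) * (if \<phi> - \<theta> = 0 then 1 else 0))) at_top"
    unfolding e_def by (intro tendsto_sum tendsto_mult_left average_exp_tendsto)
  moreover have "(\<Sum>\<theta>\<in>\<Theta>. \<Sum>\<phi>\<in>\<Theta>. of_real (c \<theta> * c \<phi>) * (if \<phi> - \<theta> = 0 then 1 else 0)) =
      complex_of_real (\<Sum>\<theta>\<in>\<Theta>. (c \<theta>)\<^sup>2)"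
    using assms(1) by (simp add: if_distrib[of "(*) _"] power2_eq_square cong: if_cong)
  ultimately show ?thesis
    by (simp add: int sum_distrib_left mult_ac)
qed

section \<open>Flat idempotents\<close>

context group
begin

lemma idempotent_one_eq_sum_squares:
  fixes f :: "'a \<Rightarrow> real"
  assumes idem: "\<And>x. x \<in> carrier G \<Longrightarrow> (\<Sum>y\<in>carrier G. f (x \<otimes> inv y) * f y) = f x"
    and sym: "\<And>x. x \<in> carrier G \<Longrightarrow> f (inv x) = f x"
  shows "f \<one> = (\<Sum>y\<in>carrier G. (f y)\<^sup>2)"
  using idem[of \<one>] by (simp add: sym power2_eq_square)

text \<open>Apply the arithmetic-geometric mean inequality to each term of the convolution; after
  translation, both sums of squares equal \<open>f \<one>\<close>.\<close>

lemma abs_idempotent_le: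
  fixes f :: "'a \<Rightarrow> real"
  assumes idem: "\<And>x. x \<in> carrier G \<Longrightarrow> (\<Sum>y\<in>carrier G. f (x \<otimes> inv y) * f y) = f x"
    and sym: "\<And>x. x \<in> carrier G \<Longrightarrow> f (inv x) = f x"
    and x: "x \<in> carrier G"
  shows "\<bar>f x\<bar> \<le> f \<one>"
proof -
  have "\<bar>f x\<bar> \<le> (\<Sum>y\<in>carrier G. \<bar>f (x \<otimes> inv y) * f y\<bar>)"
    using idem[OF x] sum_abs[of "\<lambda>y. f (x \<otimes> inv y) * f y" "carrier G"] by simp
  also have "\<dots> \<le> (\<Sum>y\<in>carrier G. ((f (x \<otimes> inv y))\<^sup>2 + (f y)\<^sup>2) / 2)"
  proof (rule sum_mono)
    fix y
    show "\<bar>f (x \<otimes> inv y) * f y\<bar> \<le> ((f (x \<otimes> inv y))\<^sup>2 + (f y)\<^sup>2) / 2"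
      using sum_squares_bound[of "\<bar>f (x \<otimes> inv y)\<bar>" "\<bar>f y\<bar>"] by (simp add: abs_mult)
  qed
  also have "\<dots> = f \<one>"
    using sum_carrier_div[OF x, of "\<lambda>y. (f y)\<^sup>2"]
    by (simp add: sum.distrib sum_divide_distrib[symmetric] idempotent_one_eq_sum_squares[OF idem sym])
  finally show ?thesis .
qed

lemma idempotent_one_le:
  fixes f :: "'a \<Rightarrow> real"
  assumes idem: "\<And>x. x \<in> carrier G \<Longrightarrow> (\<Sum>y\<in>carrier G. f (x \<otimes> inv y) * f y) = f x"
    and sym: "\<And>x. x \<in> carrier G \<Longrightarrow> f (inv x) = f x"
  shows "f \<one> \<le> card (carrier G) * (f \<one>)\<^sup>2"
proof -
  have "f \<one> = (\<Sum>y\<in>carrier G. (f y)\<^sup>2)" by (rule idempotent_one_eq_sum_squares[OF idem sym])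
  also have "\<dots> \<le> (\<Sum>y\<in>carrier G. (f \<one>)\<^sup>2)"
    using abs_idempotent_le[of f, OF idem sym]
    by (intro sum_mono) (metis abs_le_square_iff abs_of_nonneg abs_ge_zero order_trans)
  finally show ?thesis by simp
qed

section \<open>The equality case of \<open>idempotent_one_le\<close>\<close>

context
  fixes f :: "'a \<Rightarrow> real"
  assumes fin: "finite (carrier G)"
    and idem: "\<And>x. x \<in> carrier G \<Longrightarrow> (\<Sum>y\<in>carrier G. f (x \<otimes> inv y) * f y) = f x"
    and sym: "\<And>x. x \<in> carrier G \<Longrightarrow> f (inv x) = f x"
    and flat: "card (carrier G) * (f \<one>)\<^sup>2 = f \<one>"
begin

text \<open>By \<open>flat\<close>, the nonnegative gaps between \<open>(f \<one>)\<^sup>2\<close>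
  and \<open>(f y)\<^sup>2\<close> sum to 0.\<close>

lemma flat_idempotent_square:
  assumes "x \<in> carrier G"
  shows "(f x)\<^sup>2 = (f \<one>)\<^sup>2"
proof -
  have le: "(f y)\<^sup>2 \<le> (f \<one>)\<^sup>2" if "y \<in> carrier G" for y
    using abs_idempotent_le[of f, OF idem sym that]
    by (metis abs_le_square_iff abs_of_nonneg abs_ge_zero order_trans)
  have "(\<Sum>y\<in>carrier G. (f \<one>)\<^sup>2 - (f y)\<^sup>2) = 0"
    using flat idempotent_one_eq_sum_squares[of f, OF idem sym] by (simp add: sum_subtractf)
  with fin le assms show ?thesis by (subst (asm) sum_nonneg_eq_0_iff) auto
qed

text \<open>All \<open>card (carrier G)\<close> products with \<open>x\<close> fixed are at most
  \<open>f \<one> ^ 3\<close>, and idempotency makes their sum attain this bound. For nonzero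
  \<open>f\<close> this is multiplicativity of \<open>f\<close> divided by \<open>f \<one>\<close>,
  whose values are 1 and -1.\<close>

lemma flat_idempotent_product:
  assumes "x \<in> carrier G" "y \<in> carrier G"
  shows "f x * f (x \<otimes> inv y) * f y = f \<one> ^ 3"
proof -
  have nn: "0 \<le> f \<one>" using abs_idempotent_le[of f, OF idem sym one_closed] by linarith
  then have abs: "\<bar>f z\<bar> = f \<one>" if "z \<in> carrier G" for z
    using flat_idempotent_square[OF that] by (metis abs_of_nonneg power2_eq_iff abs_minus_cancel)
  have le: "f x * f (x \<otimes> inv z) * f z \<le> f \<one> ^ 3" if "z \<in> carrier G" for z
  proof -
    have "f x * f (x \<otimes> inv z) * f z \<le> \<bar>f x * f (x \<otimes> inv z) * f z\<bar>" by simp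
    also have "\<dots> = f \<one> ^ 3"
      using assms(1) that by (simp only: abs_mult abs m_closed inv_closed power3_eq_cube)
    finally show ?thesis .
  qed
  have "(\<Sum>z\<in>carrier G. f x * f (x \<otimes> inv z) * f z) = f x * f x"
    using idem[OF assms(1)] by (simp add: sum_distrib_left[symmetric] mult.assoc)
  also have "\<dots> = card (carrier G) * f \<one> ^ 3"
    using flat_idempotent_square[OF assms(1)] flat by (simp add: power2_eq_square power3_eq_cube)
  finally have "(\<Sum>z\<in>carrier G. f \<one> ^ 3 - f x * f (x \<otimes> inv z) * f z) = 0"
    by (simp add: sum_subtractf)
  then have "\<forall>z\<in>carrier G. f \<one> ^ 3 - f x * f (x \<otimes> inv z) * f z = 0"
    using fin le by (subst (asm) sum_nonneg_eq_0_iff) auto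
  with assms(2) show ?thesis by (simp del: mult_cancel_left)
qed

lemma flat_idempotent_commutator:
  assumes x: "x \<in> carrier G" and y: "y \<in> carrier G"
  shows "f (x \<otimes> y \<otimes> inv (y \<otimes> x)) = f \<one>"
proof (cases "f \<one> = 0")
  case True
  then show ?thesis using flat_idempotent_square[of "x \<otimes> y \<otimes> inv (y \<otimes> x)"] x y by simp
next
  case False
  have nz: "f z \<noteq> 0" if "z \<in> carrier G" for z
    using flat_idempotent_square[OF that] False by auto
  \<comment> \<open>The right-hand side and \<open>f u * f v\<close> are symmetric in
    \<open>u\<close> and \<open>v\<close>, which forces
    \<open>f (x \<otimes> y) = f (y \<otimes> x)\<close>.\<close>
  have *: "f (u \<otimes> v) * f u * f v = f \<one> ^ 3" if "u \<in> carrier G" "v \<in> carrier G" for u v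
    using flat_idempotent_product[of "u \<otimes> v" v] that by (simp add: m_assoc)
  have "f (x \<otimes> y) * (f x * f y) = f (y \<otimes> x) * (f x * f y)"
    using *[OF x y] *[OF y x] by (simp add: mult_ac)
  then have "f (x \<otimes> y) = f (y \<otimes> x)" using nz[OF x] nz[OF y] by simp
  \<comment> \<open>The product rule for \<open>x \<otimes> y\<close> and
    \<open>y \<otimes> x\<close>, whose equal values multiply to
    \<open>(f \<one>)\<^sup>2\<close>.\<close>
  then have "(f \<one>)\<^sup>2 * f (x \<otimes> y \<otimes> inv (y \<otimes> x)) = f \<one> ^ 3"
    using flat_idempotent_product[of "x \<otimes> y" "y \<otimes> x"] flat_idempotent_square[of "x \<otimes> y"] x y
    by (simp add: power2_eq_square) (metis mult.commute mult.assoc)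
  then show ?thesis using False by (simp add: power2_eq_square power3_eq_cube)
qed

end

lemma comm_group_if_flat_decomposition:
  fixes f :: "'i \<Rightarrow> 'a \<Rightarrow> real"
  assumes fin: "finite (carrier G)" "finite I"
    and idem: "\<And>i x. i \<in> I \<Longrightarrow> x \<in> carrier G \<Longrightarrow>
      (\<Sum>y\<in>carrier G. f i (x \<otimes> inv y) * f i y) = f i x"
    and sym: "\<And>i x. i \<in> I \<Longrightarrow> x \<in> carrier G \<Longrightarrow> f i (inv x) = f i x"
    and unit: "\<And>x. x \<in> carrier G \<Longrightarrow> (\<Sum>i\<in>I. f i x) = (if x = \<one> then 1 else 0)"
    and avg: "(\<Sum>i\<in>I. (f i \<one>)\<^sup>2) = 1 / card (carrier G)"
  shows "comm_group G"
proof -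
  have "card (carrier G) \<noteq> 0" using fin(1) one_closed by auto
  \<comment> \<open>The first terms sum to 1 by \<open>avg\<close>, the second by
    \<open>unit\<close> at \<one>. As every difference is nonnegative, each one vanishes.\<close>
  then have "(\<Sum>i\<in>I. card (carrier G) * (f i \<one>)\<^sup>2 - f i \<one>) = 0"
    using unit[OF one_closed] avg by (simp add: sum_subtractf sum_distrib_left[symmetric])
  moreover have "f i \<one> \<le> card (carrier G) * (f i \<one>)\<^sup>2" if "i \<in> I" for i
    using idempotent_one_le[of "f i"] idem sym that by blast
  ultimately have flat: "card (carrier G) * (f i \<one>)\<^sup>2 = f i \<one>" if "i \<in> I" for i
    using fin(2) that by (subst (asm) sum_nonneg_eq_0_iff) auto
  have "x \<otimes> y = y \<otimes> x" if xy: "x \<in> carrier G" "y \<in> carrier G" for x y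
  proof -
    have "f i (x \<otimes> y \<otimes> inv (y \<otimes> x)) = f i \<one>" if "i \<in> I" for i
      using flat_idempotent_commutator[of "f i" x y] fin(1) idem sym flat xy that by blast
    \<comment> \<open>The indicator of \<one> takes the same value at the commutator as at
      \<one>.\<close>
    then have "(\<Sum>i\<in>I. f i (x \<otimes> y \<otimes> inv (y \<otimes> x))) = 1"
      using unit[OF one_closed] by simp
    then have "x \<otimes> y \<otimes> inv (y \<otimes> x) = \<one>"
      using unit[of "x \<otimes> y \<otimes> inv (y \<otimes> x)"] xy by (simp split: if_splits)
    then show ?thesis using xy by (simp add: inv_solve_right')
  qed
  then show ?thesis by (intro group_comm_groupI) auto
qed

end

section \<open>Cayley graphs\<close>

theorem corollary8:
  fixes G :: "('a, 'b) monoid_scheme" and S :: "'a set"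
  assumes "group G" and "finite (carrier G)" and "\<not> comm_group G"
    and "S \<subseteq> carrier G" and "m_inv G ` S = S" and "\<one>\<^bsub>G\<^esub> \<notin> S"
  shows "\<not> average_uniform_mixing (cayley_graph G S)"
proof
  assume unif: "average_uniform_mixing (cayley_graph G S)"
  interpret symmetric_subset G S
    using assms by (simp add: symmetric_subset_def symmetric_subset_axioms_def)
  obtain \<Theta> :: "real set" and f where fin: "finite \<Theta>"
    and powers: "\<And>k x. x \<in> carrier G \<Longrightarrow>
      ev (monom 1 k) x = (\<Sum>\<theta>\<in>\<Theta>. of_real (\<theta> ^ k * f \<theta> x))"
    and idem: "\<And>\<theta> x. \<theta> \<in> \<Theta> \<Longrightarrow> x \<in> carrier G \<Longrightarrow>
      (\<Sum>y\<in>carrier G. f \<theta> (x \<otimes>\<^bsub>G\<^esub> inv\<^bsub>G\<^esub> y) * f \<theta> y) = f \<theta> x"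
    and sym: "\<And>\<theta> x. \<theta> \<in> \<Theta> \<Longrightarrow> x \<in> carrier G \<Longrightarrow> f \<theta> (inv\<^bsub>G\<^esub> x) = f \<theta> x"
    by (rule exists_spectral_decomposition) blast
  have verts: "pverts (cayley_graph G S) = carrier G" by (simp add: cayley_graph_def)
  have trans: "transition_matrix (cayley_graph G S) t \<one>\<^bsub>G\<^esub> \<one>\<^bsub>G\<^esub> =
      (\<Sum>\<theta>\<in>\<Theta>. of_real (f \<theta> \<one>\<^bsub>G\<^esub>) * exp (- (\<i> * of_real t) * of_real \<theta>))" for t
  proof -
    \<comment> \<open>The exponential series of the matrix splits over \<Theta> into scalar
      exponential series, compared term by term.\<close>
    have coeff: "(\<Sum>\<theta>\<in>\<Theta>. of_real (f \<theta> \<one>\<^bsub>G\<^esub>) * ((- (\<i> * of_real t) * of_real \<theta>) ^ k /\<^sub>R fact k)) =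
      cmatrix_power (carrier G) (\<lambda>x y. - (\<i> * of_real t) * adjacency_matrix (cayley_graph G S) x y)
        k \<one>\<^bsub>G\<^esub> \<one>\<^bsub>G\<^esub> / fact k" for k
      unfolding cmatrix_power_adjacency[OF one_closed] powers[OF one_closed]
        sum_distrib_left sum_divide_distrib power_mult_distrib
      by (intro sum.cong refl) (simp add: scaleR_conv_of_real field_simps)
    have "(\<lambda>k. \<Sum>\<theta>\<in>\<Theta>. of_real (f \<theta> \<one>\<^bsub>G\<^esub>) * ((- (\<i> * of_real t) * of_real \<theta>) ^ k /\<^sub>R fact k))
      sums (\<Sum>\<theta>\<in>\<Theta>. of_real (f \<theta> \<one>\<^bsub>G\<^esub>) * exp (- (\<i> * of_real t) * of_real \<theta>))"
      by (intro sums_sum sums_mult exp_converges)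
    then show ?thesis
      unfolding coeff transition_matrix_def cmatrix_exp_def verts by (rule sums_unique[symmetric])
  qed
  \<comment> \<open>The single diagonal entry at \<one> suffices for the contradiction.\<close>
  have "average_mixing_matrix (cayley_graph G S) \<one>\<^bsub>G\<^esub> \<one>\<^bsub>G\<^esub> =
      of_real (\<Sum>\<theta>\<in>\<Theta>. (f \<theta> \<one>\<^bsub>G\<^esub>)\<^sup>2)"
    unfolding average_mixing_matrix_def mixing_matrix_def trans
    by (rule tendsto_Lim[OF _ average_norm_square_tendsto[OF fin]]) simp
  also have "average_mixing_matrix (cayley_graph G S) \<one>\<^bsub>G\<^esub> \<one>\<^bsub>G\<^esub> = of_real (1 / card (carrier G))"
    using unif by (simp add: average_uniform_mixing_def verts)
  finally have avg: "(\<Sum>\<theta>\<in>\<Theta>. (f \<theta> \<one>\<^bsub>G\<^esub>)\<^sup>2) = 1 / card (carrier G)"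
    by (simp only: of_real_eq_iff)
  have unit: "(\<Sum>\<theta>\<in>\<Theta>. f \<theta> x) = (if x = \<one>\<^bsub>G\<^esub> then 1 else 0)" if "x \<in> carrier G" for x
  proof -
    \<comment> \<open>The zeroth power of \<open>gen\<close> is \<open>unit\<close>;
      \<open>\<theta> ^ 0 = 1\<close> also for \<theta> = 0, so no idempotent is lost.\<close>
    have "complex_of_real (\<Sum>\<theta>\<in>\<Theta>. f \<theta> x) = of_real (if x = \<one>\<^bsub>G\<^esub> then 1 else 0)"
      using powers[OF that, of 0, symmetric] by (simp add: ev_1 unit_def)
    then show ?thesis by (simp only: of_real_eq_iff)
  qed
  have "comm_group G"
    by (rule comm_group_if_flat_decomposition[OF finite_carrier fin idem sym unit avg])
  with assms(3) show False by simp
qed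

end
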